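(* For all characters $A,B,B',C\in\widehat{\mathbb F_q}$ and all $x,y\in\mathbb F_q$, $$\mathbb F_1(A;B,B';C;x,y)=\frac1{(q-1)^2}\sum_{\chi,\lambda}\binom{A\chi\lambda}{C\chi\lambda}\binom{B\chi}{\chi}\binom{B'\lambda}{\lambda}\chi(x)\lambda(y),$$ where $\chi$ and $\lambda$ each range over all of $\widehat{\mathbb F_q}$.
   Context: Let $p$ be a prime, $r\ge1$ an integer, $q=p^r$, and $\mathbb F_q$ the finite field with $q$ elements. $\widehat{\mathbb F_q}$ denotes the group of (complex-valued) multiplicative characters of $\mathbb F_q^*$; every character $\chi$, including the trivial character $\varepsilon$, is extended to $\mathbb F_q$ by $\chi(0)=0$. $\overline\chi$ is the inverse of $\chi$. Juxtaposition of characters denotes their product, and e.g. $AC(-1)$ means $(AC)(-1)$. For $A,B\in\widehat{\mathbb F_q}$, the Jacobi sum is $J(A,B)=\sum_{u\in\mathbb F_q}A(u)B(1-u)$, and $$\binom AB=B(-1)J(A,\overline B).$$ For $A,B,B',C\in\widehat{\mathbb F_q}$ and $x,y\in\mathbb F_q$, $$\mathbb F_1(A;B,B';C;x,y)=\varepsilon(xy)\,AC(-1)\sum_{u\in\mathbb F_q}A(u)\,\overline AC(1-u)\,\overline B(1-ux)\,\overline{B'}(1-uy),$$ where $\overline AC$ denotes the product of $\overline A$ and $C$. *)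

theory Defs
  imports
    Complex_Main
    "HOL-Computational_Algebra.Primes"
    "HOL-Library.FuncSet"
    "HOL-Library.Cardinality"
begin

text \<open>Every character, the trivial one included, takes the value 0 at 0.\<close>

definition mult_chars :: "('a::field \<Rightarrow> complex) set" where
  "mult_chars = {\<chi>. \<chi> 0 = 0 \<and> (\<forall>x. x \<noteq> 0 \<longrightarrow> \<chi> x \<noteq> 0) \<and>
     (\<forall>x y. x \<noteq> 0 \<longrightarrow> y \<noteq> 0 \<longrightarrow> \<chi> (x * y) = \<chi> x * \<chi> y)}"

definition triv_char :: "'a::field \<Rightarrow> complex" where
  "triv_char x = (if x = 0 then 0 else 1)"

definition char_mult ::
    "('a::field \<Rightarrow> complex) \<Rightarrow> ('a \<Rightarrow> complex) \<Rightarrow> 'a \<Rightarrow> complex"  (infixl "\<star>" 70) where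
  "A \<star> B = (\<lambda>x. A x * B x)"

text \<open>Since \<open>inverse 0 = 0\<close>, the inverse character again takes the value 0 at 0.\<close>

definition char_inv :: "('a::field \<Rightarrow> complex) \<Rightarrow> 'a \<Rightarrow> complex" where
  "char_inv A = (\<lambda>x. inverse (A x))"

definition jacobi_sum ::
    "('a::{field,finite} \<Rightarrow> complex) \<Rightarrow> ('a \<Rightarrow> complex) \<Rightarrow> complex" where
  "jacobi_sum A B = (\<Sum>u\<in>UNIV. A u * B (1 - u))"

definition char_binom ::
    "('a::{field,finite} \<Rightarrow> complex) \<Rightarrow> ('a \<Rightarrow> complex) \<Rightarrow> complex" where
  "char_binom A B = B (- 1) * jacobi_sum A (char_inv B)"

definition appell_F1 ::
    "('a::{field,finite} \<Rightarrow> complex) \<Rightarrow> ('a \<Rightarrow> complex) \<Rightarrow> ('a \<Rightarrow> complex) \<Rightarrow>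
     ('a \<Rightarrow> complex) \<Rightarrow> 'a \<Rightarrow> 'a \<Rightarrow> complex" where
  "appell_F1 A B B' C x y =
     triv_char (x * y) * (A \<star> C) (- 1) *
     (\<Sum>u\<in>UNIV. A u * (char_inv A \<star> C) (1 - u) * char_inv B (1 - u * x) * char_inv B' (1 - u * y))"

lemma triv_char_in_mult_chars: "triv_char \<in> mult_chars"
  by (auto simp: mult_chars_def triv_char_def)

lemma char_mult_in_mult_chars:
  "A \<in> mult_chars \<Longrightarrow> B \<in> mult_chars \<Longrightarrow> A \<star> B \<in> mult_chars"
  by (auto simp: mult_chars_def char_mult_def)

lemma char_inv_in_mult_chars: "A \<in> mult_chars \<Longrightarrow> char_inv A \<in> mult_chars"
  by (auto simp: mult_chars_def char_inv_def)

lemma char_mult_inv: "A \<in> mult_chars \<Longrightarrow> A \<star> char_inv A = triv_char"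
  by (auto simp: mult_chars_def char_inv_def char_mult_def triv_char_def fun_eq_iff)

text \<open>Sums over \<^const>\<open>mult_chars\<close> are genuine finite sums.\<close>

lemma finite_mult_chars: "finite (mult_chars :: ('a::{field,finite} \<Rightarrow> complex) set)"
proof -
  have "\<exists>n>0. x ^ n = 1" if "x \<noteq> 0" for x :: 'a
  proof -
    have "\<not> inj (\<lambda>n::nat. x ^ n)"
      using finite_imageD[of "\<lambda>n::nat. x ^ n" UNIV] by auto
    then obtain m n :: nat where "m < n" "x ^ m = x ^ n"
      by (metis (mono_tags, lifting) injI linorder_neqE_nat)
    then have "x ^ m * x ^ (n - m) = x ^ m * 1"
      using power_add[of x m "n - m"] by simp
    then have "x ^ (n - m) = 1"
      using that by simp
    then show ?thesis
      using \<open>m < n\<close> by (intro exI[of _ "n - m"]) simp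
  qed
  then obtain N where N: "\<And>x::'a. x \<noteq> 0 \<Longrightarrow> N x > (0::nat) \<and> x ^ N x = 1"
    by metis
  define S where "S = (\<lambda>x::'a. if x = 0 then {0} else {z::complex. z ^ N x = 1})"
  have "finite (PiE UNIV S)"
    using N by (intro finite_PiE) (auto simp: S_def intro: finite_nth_roots)
  moreover have "mult_chars \<subseteq> PiE UNIV S"
  proof
    fix \<chi> :: "'a \<Rightarrow> complex"
    assume chi: "\<chi> \<in> mult_chars"
    have one: "\<chi> 1 = 1"
    proof -
      have "\<chi> (1 * 1) = \<chi> 1 * \<chi> 1" "\<chi> 1 \<noteq> 0"
        using chi by (simp_all add: mult_chars_def del: mult_1_left mult_1_right)
      then show ?thesis
        by simp
    qed
    have pow: "\<chi> (x ^ n) = \<chi> x ^ n" if "x \<noteq> 0" for x n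
      using that chi one by (induction n) (auto simp: mult_chars_def)
    have "\<chi> x \<in> S x" for x
    proof (cases "x = 0")
      case True
      then show ?thesis
        using chi by (simp add: S_def mult_chars_def)
    next
      case False
      then have "\<chi> x ^ N x = \<chi> 1"
        using pow[of x "N x"] N[of x] by simp
      then show ?thesis
        using False one by (simp add: S_def)
    qed
    then show "\<chi> \<in> PiE UNIV S"
      by auto
  qed
  ultimately show ?thesis
    using finite_subset by blast
qed

end

theory Submission
  imports "HOL-Algebra.Algebraic_Closure_Type" Defs
begin

text \<open>
  Two facts about characters carry the proof. The first is the orthogonality relation
  \<open>\<Sum>\<chi>. \<chi> z = (if z = 1 then q - 1 else 0)\<close> (\<open>sum_mult_chars\<close>): because \<open>\<F>\<^sub>q\<^sup>*\<close> is cyclic, it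
  has an injective character \<open>\<omega>\<close>, and multiplying the sum by \<open>\<omega> z\<close> only permutes its summands, so
  it vanishes unless \<open>z = 1\<close>. The second is the finite field version of the binomial series for
  \<open>(1 - z) powr - b\<close>, namely
  \<open>\<Sum>\<chi>. char_binom (B \<star> \<chi>) \<chi> * \<chi> z = (q - 1) * char_inv B (1 - z)\<close> for \<open>z \<noteq> 0\<close>
  (\<open>char_binomial_series\<close>), which orthogonality yields once the Jacobi sums are written out.

  In the double sum of the theorem, the coefficient \<open>char_binom (A \<star> \<chi> \<star> \<psi>) (C \<star> \<chi> \<star> \<psi>)\<close> is a sum
  over \<open>u\<close> in which \<open>\<chi>\<close> and \<open>\<psi>\<close> enter only through the values \<open>\<chi> w\<close> and \<open>\<psi> w\<close> at the single point
  \<open>w = u / (u - 1)\<close>. For fixed \<open>u\<close> the double sum therefore factors into two binomial series, at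
  \<open>w * x\<close> and \<open>w * y\<close>. The map \<open>u \<mapsto> u / (u - 1)\<close> is an involution of the field without the
  point \<open>1\<close>, and taking \<open>w\<close> as the new variable of summation turns the result into
  \<^const>\<open>appell_F1\<close>. This is the analogue of Euler's integral for the Appell series, with
  orthogonality in the place of termwise integration.
\<close>

section \<open>Characters as functions on the whole field\<close>

lemma char_zero [simp]: "\<chi> \<in> mult_chars \<Longrightarrow> \<chi> 0 = 0"
  by (simp add: mult_chars_def)

lemma char_eq_0_iff: "\<chi> \<in> mult_chars \<Longrightarrow> \<chi> x = 0 \<longleftrightarrow> x = 0"
  unfolding mult_chars_def by blast

lemma char_times:
  assumes "\<chi> \<in> mult_chars"
  shows "\<chi> (x * y) = \<chi> x * \<chi> y"
proof (cases "x = 0 \<or> y = 0")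
  case True
  then show ?thesis
    using assms by auto
next
  case False
  then show ?thesis
    using assms unfolding mult_chars_def by blast
qed

lemma char_one [simp]:
  assumes "\<chi> \<in> mult_chars"
  shows "\<chi> 1 = 1"
  using char_times[OF assms, of 1 1] char_eq_0_iff[OF assms, of 1] by simp

lemma char_inverse:
  assumes "\<chi> \<in> mult_chars"
  shows "\<chi> (inverse x) = inverse (\<chi> x)"
proof (cases "x = 0")
  case False
  then have "\<chi> (inverse x) * \<chi> x = 1"
    using char_times[OF assms, of "inverse x" x] assms by simp
  then show ?thesis
    by (metis inverse_unique mult.commute)
qed (use assms in simp)

text \<open>
  Rewrites a quotient, the value \<open>u = 1\<close> included, into a product to which the multiplicativity of
  characters applies.
\<close>

lemma divide_diff_one: "a / (u - 1) = - 1 * a * inverse (1 - u)" for u :: "'a::field"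
  by (metis divide_inverse minus_diff_eq minus_divide_divide mult_minus1)

section \<open>Cyclicity and an injective character\<close>

lemma finite_field_generator:
  "\<exists>g::'a::{field,finite}. g \<noteq> 0 \<and> (\<forall>x. x \<noteq> 0 \<longrightarrow> (\<exists>i::nat. x = g ^ i))"
proof -
  define K where "K = (ring_of_type_algebra :: 'a ring)"
  interpret K: field K
    unfolding K_def by rule
  have pow: "x [^]\<^bsub>K\<^esub> (i::nat) = x ^ i" for x i
    by (induction i) (simp_all add: K_def ring_of_type_algebra_def)
  have fin: "finite (carrier K)"
    by (rule finite)
  obtain a where a: "a \<in> carrier (Multiplicative_Group.mult_of K)"
      and gen: "carrier (Multiplicative_Group.mult_of K) = {a [^]\<^bsub>K\<^esub> i | i::nat. i \<in> UNIV}"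
    using K.finite_field_mult_group_has_gen[OF fin] by blast
  have carrier: "carrier (Multiplicative_Group.mult_of K) = UNIV - {0}"
    by (simp add: K_def ring_of_type_algebra_def)
  have "\<exists>i::nat. x = a ^ i" if "x \<noteq> 0" for x
  proof -
    have "x \<in> {a [^]\<^bsub>K\<^esub> i | i::nat. i \<in> UNIV}"
      using that carrier unfolding gen by simp
    then show ?thesis
      by (simp add: pow)
  qed
  moreover have "a \<noteq> 0"
    using a unfolding carrier by simp
  ultimately show ?thesis
    by blast
qed

lemma primitive_root_power_eq_iff:
  fixes z :: "'a::field"
  assumes "z ^ n = 1" and "n > 0" and min: "\<And>k. 0 < k \<Longrightarrow> k < n \<Longrightarrow> z ^ k \<noteq> 1"
  shows "z ^ i = z ^ j \<longleftrightarrow> i mod n = j mod n"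
proof -
  have z: "z \<noteq> 0"
    using assms(1,2) by (auto simp: power_0_left)
  have red: "z ^ k = z ^ (k mod n)" for k
    using assms(1) by (metis mod_mult_div_eq mult_1_right power_add power_mult power_one)
  have less: "z ^ a \<noteq> z ^ b" if "a < b" "b < n" for a b
  proof
    assume "z ^ a = z ^ b"
    then have "z ^ a * z ^ (b - a) = z ^ a * 1"
      using that power_add[of z a "b - a"] by simp
    then have "z ^ (b - a) = 1"
      using z by simp
    then show False
      using min[of "b - a"] that by simp
  qed
  have "z ^ (i mod n) = z ^ (j mod n) \<longleftrightarrow> i mod n = j mod n"
    using less[of "i mod n" "j mod n"] less[of "j mod n" "i mod n"] assms(2)
    by (metis linorder_neqE_nat mod_less_divisor)
  then show ?thesis
    using red[of i] red[of j] by simp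
qed

lemma complex_primitive_root:
  assumes "n > 0"
  shows "\<exists>\<zeta>::complex. \<zeta> ^ n = 1 \<and> (\<forall>k. 0 < k \<and> k < n \<longrightarrow> \<zeta> ^ k \<noteq> 1)"
proof (intro exI conjI allI impI)
  let ?\<zeta> = "cis (2 * pi / real n)"
  show "?\<zeta> ^ n = 1"
    using assms by (simp add: DeMoivre)
  show "?\<zeta> ^ k \<noteq> 1" if "0 < k \<and> k < n" for k
  proof
    assume eq: "?\<zeta> ^ k = 1"
    have "inj_on (\<lambda>k. cis (2 * pi * real k / real n)) {..<n}"
      using bij_betw_roots_unity[OF assms] by (rule bij_betw_imp_inj_on)
    from inj_onD[OF this, of k 0] eq that show False
      by (simp add: DeMoivre mult_ac)
  qed
qed

text \<open>
  If \<open>g\<close> generates \<open>\<F>\<^sub>q\<^sup>*\<close> and has order \<open>n\<close>, then \<open>g\<close> and a primitive complex \<open>n\<close>-th root of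
  unity \<open>\<zeta>\<close> satisfy the same coincidences of powers, so \<open>g ^ i \<mapsto> \<zeta> ^ i\<close> is well defined and
  injective.
\<close>

lemma exists_injective_char:
  "\<exists>\<omega>::'a::{field,finite} \<Rightarrow> complex. \<omega> \<in> mult_chars \<and> (\<forall>x. \<omega> x = 1 \<longrightarrow> x = 1)"
proof -
  obtain g :: 'a where g: "g \<noteq> 0" and gen: "\<And>x. x \<noteq> 0 \<Longrightarrow> \<exists>i::nat. x = g ^ i"
    using finite_field_generator by blast
  obtain i :: nat where "inverse g = g ^ i"
    using gen[of "inverse g"] g nonzero_imp_inverse_nonzero by blast
  then have "g ^ Suc i = g * inverse g"
    by simp
  then have "g ^ Suc i = 1"
    using right_inverse[OF g] by (rule trans)
  then have ex: "\<exists>n>0. g ^ n = 1"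
    by (intro exI[of _ "Suc i"]) simp
  define n where "n = (LEAST n. n > 0 \<and> g ^ n = 1)"
  have n: "n > 0" "g ^ n = 1"
    using LeastI_ex[OF ex] unfolding n_def by simp_all
  have g_min: "g ^ k \<noteq> 1" if "0 < k" "k < n" for k
    using not_less_Least[of k "\<lambda>n. n > 0 \<and> g ^ n = 1"] that unfolding n_def by blast
  have g_iff: "g ^ i = g ^ j \<longleftrightarrow> i mod n = j mod n" for i j
    by (rule primitive_root_power_eq_iff[OF n(2,1) g_min])
  obtain \<zeta> :: complex where \<zeta>_n: "\<zeta> ^ n = 1"
      and \<zeta>_min: "\<And>k. 0 < k \<Longrightarrow> k < n \<Longrightarrow> \<zeta> ^ k \<noteq> 1"
    using complex_primitive_root[OF n(1)] by blast
  have \<zeta>_iff: "\<zeta> ^ i = \<zeta> ^ j \<longleftrightarrow> i mod n = j mod n" for i j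
    by (rule primitive_root_power_eq_iff[OF \<zeta>_n n(1) \<zeta>_min])
  have \<zeta>: "\<zeta> \<noteq> 0"
    using \<zeta>_n n by (auto simp: power_0_left)
  define \<omega> where "\<omega> = (\<lambda>x. if x = 0 then 0 else \<zeta> ^ (SOME i. g ^ i = x))"
  have \<omega>: "\<omega> (g ^ i) = \<zeta> ^ i" for i
  proof -
    have "g ^ (SOME j. g ^ j = g ^ i) = g ^ i"
      by (rule someI) simp
    then have "\<zeta> ^ (SOME j. g ^ j = g ^ i) = \<zeta> ^ i"
      by (simp only: g_iff \<zeta>_iff)
    then show ?thesis
      using g by (simp add: \<omega>_def)
  qed
  have \<omega>_0: "\<omega> 0 = 0"
    by (simp add: \<omega>_def)
  have \<omega>_nz: "\<omega> x \<noteq> 0" if "x \<noteq> 0" for x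
    using \<zeta> that by (simp add: \<omega>_def)
  have \<omega>_mult: "\<omega> (x * y) = \<omega> x * \<omega> y" if "x \<noteq> 0" "y \<noteq> 0" for x y
  proof -
    obtain i j :: nat where "x = g ^ i" "y = g ^ j"
      using gen \<open>x \<noteq> 0\<close> \<open>y \<noteq> 0\<close> by blast
    then have "x * y = g ^ (i + j)" "\<omega> x * \<omega> y = \<zeta> ^ (i + j)"
      by (simp_all only: \<omega> power_add)
    then show ?thesis
      by (simp only: \<omega>)
  qed
  have "\<omega> \<in> mult_chars"
    unfolding mult_chars_def using \<omega>_0 \<omega>_nz \<omega>_mult by blast
  moreover have "x = 1" if "\<omega> x = 1" for x
  proof -
    have "x \<noteq> 0"
      using that \<omega>_0 by auto
    then obtain i :: nat where "x = g ^ i"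
      using gen by blast
    then have "\<zeta> ^ i = \<zeta> ^ 0"
      using that \<omega> by simp
    then have "g ^ i = g ^ 0"
      by (simp only: g_iff \<zeta>_iff)
    then show ?thesis
      using \<open>x = g ^ i\<close> by simp
  qed
  ultimately show ?thesis
    by blast
qed

section \<open>Orthogonality\<close>

lemma sum_mult_chars_eq_0:
  fixes z :: "'a::{field,finite}"
  assumes "z \<noteq> 1"
  shows "(\<Sum>\<chi>\<in>mult_chars. \<chi> z) = 0"
proof (cases "z = 0")
  case False
  obtain \<omega> :: "'a \<Rightarrow> complex" where \<omega>: "\<omega> \<in> mult_chars" "\<And>x. \<omega> x = 1 \<Longrightarrow> x = 1"
    using exists_injective_char by blast
  have inv: "\<rho> \<star> (\<sigma> \<star> \<chi>) = \<chi>"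
    if "\<rho> \<star> \<sigma> = triv_char" "\<chi> \<in> mult_chars" for \<rho> \<sigma> \<chi> :: "'a \<Rightarrow> complex"
    using that by (auto simp: fun_eq_iff char_mult_def triv_char_def simp flip: mult.assoc)
  have \<omega>_inv: "\<omega> \<star> char_inv \<omega> = triv_char" "char_inv \<omega> \<star> \<omega> = triv_char"
    using char_mult_inv[OF \<omega>(1)] by (simp_all add: char_mult_def mult.commute)
  have "(\<Sum>\<chi>\<in>mult_chars. \<chi> z) = (\<Sum>\<chi>\<in>mult_chars. (\<omega> \<star> \<chi>) z)"
    by (rule sum.reindex_bij_witness[where i = "\<lambda>\<chi>. \<omega> \<star> \<chi>" and j = "\<lambda>\<chi>. char_inv \<omega> \<star> \<chi>"])
       (simp_all add: inv \<omega>_inv \<omega>(1) char_mult_in_mult_chars char_inv_in_mult_chars)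
  also have "\<dots> = \<omega> z * (\<Sum>\<chi>\<in>mult_chars. \<chi> z)"
    by (simp add: char_mult_def sum_distrib_left)
  finally show ?thesis
    using \<omega>(2)[of z] assms by auto
qed simp

lemma sum_nontrivial_char:
  fixes \<chi> :: "'a::{field,finite} \<Rightarrow> complex"
  assumes "\<chi> \<in> mult_chars" and "\<chi> \<noteq> triv_char"
  shows "(\<Sum>x\<in>UNIV. \<chi> x) = 0"
proof -
  obtain a where a: "a \<noteq> 0" "\<chi> a \<noteq> 1"
    using assms by (auto simp: fun_eq_iff triv_char_def split: if_splits)
  have "(\<Sum>x\<in>UNIV. \<chi> x) = (\<Sum>x\<in>UNIV. \<chi> (a * x))"
    by (rule sum.reindex_bij_witness[where i = "\<lambda>x. a * x" and j = "\<lambda>x. x / a"])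
       (simp_all add: a)
  also have "\<dots> = \<chi> a * (\<Sum>x\<in>UNIV. \<chi> x)"
    by (simp add: char_times[OF assms(1)] sum_distrib_left)
  finally show ?thesis
    using a by simp
qed

lemma sum_mult_chars_1:
  "(\<Sum>\<chi>\<in>mult_chars. \<chi> (1::'a::{field,finite}))
     = of_nat (card (mult_chars :: ('a \<Rightarrow> complex) set))"
proof -
  have "(\<Sum>\<chi>\<in>mult_chars. \<chi> (1::'a)) = (\<Sum>\<chi>\<in>(mult_chars :: ('a \<Rightarrow> complex) set). 1)"
    by (intro sum.cong) simp_all
  then show ?thesis
    by simp
qed

text \<open>
  Summing \<open>\<chi> x\<close> over all pairs \<open>(\<chi>, x)\<close> counts the characters when \<open>\<chi>\<close> is summed first and the
  nonzero field elements when \<open>x\<close> is summed first.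
\<close>

lemma card_mult_chars:
  "of_nat (card (mult_chars :: ('a::{field,finite} \<Rightarrow> complex) set)) = (of_nat CARD('a) - 1 :: complex)"
proof -
  let ?M = "mult_chars :: ('a \<Rightarrow> complex) set"
  have "(\<Sum>\<chi>\<in>?M. \<chi> x) = (if x = 1 then of_nat (card ?M) else 0)" for x
    by (simp add: sum_mult_chars_eq_0 sum_mult_chars_1)
  then have "of_nat (card ?M) = (\<Sum>x\<in>UNIV. \<Sum>\<chi>\<in>?M. \<chi> x)"
    by simp
  also have "\<dots> = (\<Sum>\<chi>\<in>?M. \<Sum>x\<in>UNIV. \<chi> x)"
    by (rule sum.swap)
  also have "\<dots> = (\<Sum>\<chi>\<in>?M. if \<chi> = triv_char then (\<Sum>x\<in>UNIV. triv_char (x::'a)) else 0)"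
    by (intro sum.cong) (simp_all add: sum_nontrivial_char)
  also have "\<dots> = (\<Sum>x\<in>UNIV. triv_char (x::'a))"
    by (simp add: finite_mult_chars triv_char_in_mult_chars)
  also have "\<dots> = (\<Sum>x\<in>UNIV - {0::'a}. 1)"
    by (intro sum.mono_neutral_cong_right) (auto simp: triv_char_def)
  also have "\<dots> = of_nat CARD('a) - 1"
    by (simp add: card_Diff_singleton of_nat_diff)
  finally show ?thesis .
qed

lemma sum_mult_chars:
  fixes z :: "'a::{field,finite}"
  shows "(\<Sum>\<chi>\<in>mult_chars. \<chi> z) = (if z = 1 then of_nat CARD('a) - 1 else 0)"
  using card_mult_chars[where 'a = 'a] by (simp add: sum_mult_chars_eq_0 sum_mult_chars_1)

section \<open>The binomial series\<close>

text \<open>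
  After the Jacobi sums are expanded, the characters \<open>\<chi>\<close> are all evaluated at \<open>u * z / (u - 1)\<close>.
  Orthogonality retains the \<open>u\<close> for which this is \<open>1\<close>, that is \<open>u = 1 / (1 - z)\<close>.
  At \<open>z = 0\<close> the series vanishes, like all \<open>\<chi> 0\<close>, whereas \<open>char_inv B 1 = 1\<close>.
\<close>

lemma char_binomial_series:
  fixes B :: "'a::{field,finite} \<Rightarrow> complex"
  assumes B: "B \<in> mult_chars" and "z \<noteq> 0"
  shows "(\<Sum>\<chi>\<in>mult_chars. char_binom (B \<star> \<chi>) \<chi> * \<chi> z)
           = (of_nat CARD('a) - 1) * char_inv B (1 - z)"
proof -
  have expand: "char_binom (B \<star> \<chi>) \<chi> * \<chi> z = (\<Sum>u\<in>UNIV. B u * \<chi> (u * z / (u - 1)))"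
    if \<chi>: "\<chi> \<in> mult_chars" for \<chi>
  proof -
    have "\<chi> (u * z / (u - 1)) = \<chi> (- 1) * \<chi> u * \<chi> z * inverse (\<chi> (1 - u))" for u
      by (simp only: divide_diff_one char_times[OF \<chi>] char_inverse[OF \<chi>] mult_ac)
    then show ?thesis
      by (simp add: char_binom_def jacobi_sum_def char_mult_def char_inv_def
          sum_distrib_left sum_distrib_right mult_ac)
  qed
  \<comment> \<open>For \<open>z = 1\<close> no \<open>u\<close> is retained, in agreement with \<open>B (inverse 0) = 0\<close>.\<close>
  have point: "B u * (if u * z / (u - 1) = 1 then c else 0)
      = (if u = inverse (1 - z) then c * B u else 0)" for u c
  proof (cases "u = 1 \<or> z = 1")
    case True
    then have "u * z / (u - 1) \<noteq> 1"
      by (auto simp: divide_eq_eq)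
    then show ?thesis
      using True B \<open>z \<noteq> 0\<close> by (auto simp: inverse_eq_divide)
  next
    case False
    then have "u * z / (u - 1) = 1 \<longleftrightarrow> u * (1 - z) = 1"
      by (auto simp: divide_eq_eq algebra_simps)
    also have "\<dots> \<longleftrightarrow> u = inverse (1 - z)"
      using False by (auto simp: inverse_eq_divide eq_divide_eq)
    finally show ?thesis
      by simp
  qed
  have "(\<Sum>\<chi>\<in>mult_chars. char_binom (B \<star> \<chi>) \<chi> * \<chi> z)
      = (\<Sum>u\<in>UNIV. B u * (\<Sum>\<chi>\<in>mult_chars. \<chi> (u * z / (u - 1))))"
    unfolding sum_distrib_left by (subst sum.swap) (intro sum.cong refl expand)
  also have "\<dots> = (of_nat CARD('a) - 1) * B (inverse (1 - z))"
    by (simp only: sum_mult_chars point) simp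
  finally show ?thesis
    by (simp add: char_inverse[OF B] char_inv_def)
qed

section \<open>The expansion of the Appell function\<close>

lemma char_binom_twist:
  assumes "A \<in> mult_chars" and C: "C \<in> mult_chars" and \<phi>: "\<phi> \<in> mult_chars"
  shows "char_binom (A \<star> \<phi>) (C \<star> \<phi>)
    = C (- 1) * (\<Sum>u\<in>UNIV. A u * char_inv C (1 - u) * \<phi> (u / (u - 1)))"
proof -
  have "\<phi> (u / (u - 1)) = \<phi> (- 1) * \<phi> u * inverse (\<phi> (1 - u))" for u
    by (simp only: divide_diff_one char_times[OF \<phi>] char_inverse[OF \<phi>])
  then show ?thesis
    by (simp add: char_binom_def jacobi_sum_def char_mult_def char_inv_def sum_distrib_left mult_ac)
qed

text \<open>
  The substitution of the involution \<open>u \<mapsto> u / (u - 1)\<close> in a sum of Euler type; with \<open>w\<close> for the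
  image of \<open>u\<close>, the complement \<open>1 - u\<close> becomes \<open>1 / (1 - w)\<close>.
\<close>

lemma sum_char_involution:
  fixes A C :: "'a::{field,finite} \<Rightarrow> complex"
  assumes A: "A \<in> mult_chars" and C: "C \<in> mult_chars"
  shows "(\<Sum>u\<in>UNIV. A u * char_inv C (1 - u) * f (u / (u - 1)))
       = A (- 1) * (\<Sum>w\<in>UNIV. A w * (char_inv A \<star> C) (1 - w) * f w)"
proof -
  define h where "h = (\<lambda>w::'a. w / (w - 1))"
  have inv: "h (h w) = w" "h w \<noteq> 1" if "w \<noteq> 1" for w
  proof -
    have "h w - 1 = 1 / (w - 1)"
      using that by (simp add: h_def field_simps)
    then show "h (h w) = w" "h w \<noteq> 1"
      using that by (auto simp: h_def)
  qed
  have euler: "A (h w) * char_inv C (1 - h w)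
      = A (- 1) * (A w * (char_inv A \<star> C) (1 - w))" if "w \<noteq> 1" for w
  proof -
    have "h w = - 1 * w * inverse (1 - w)"
      unfolding h_def by (rule divide_diff_one)
    moreover have "1 - h w = inverse (1 - w)"
      using that by (simp add: h_def field_simps)
    ultimately show ?thesis
      by (simp only: char_times[OF A] char_inverse[OF A] char_inverse[OF C]
          char_inv_def char_mult_def inverse_inverse_eq mult_ac)
  qed
  have "(\<Sum>u\<in>UNIV. A u * char_inv C (1 - u) * f (h u))
      = (\<Sum>u\<in>UNIV - {1}. A u * char_inv C (1 - u) * f (h u))"
    using C by (intro sum.mono_neutral_right) (auto simp: char_inv_def)
  also have "\<dots> = (\<Sum>w\<in>UNIV - {1}. A (- 1) * (A w * (char_inv A \<star> C) (1 - w)) * f w)"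
    by (rule sum.reindex_bij_witness[where i = h and j = h])
       (simp_all add: inv flip: euler)
  also have "\<dots> = (\<Sum>w\<in>UNIV. A (- 1) * (A w * (char_inv A \<star> C) (1 - w)) * f w)"
    using C by (intro sum.mono_neutral_left) (auto simp: char_mult_def)
  also have "\<dots> = A (- 1) * (\<Sum>w\<in>UNIV. A w * (char_inv A \<star> C) (1 - w) * f w)"
    by (simp add: sum_distrib_left mult_ac)
  finally show ?thesis
    by (simp only: h_def)
qed

theorem theorem1p3:
  fixes A B B' C :: "'a::{field,finite} \<Rightarrow> complex"
    and x y :: 'a
    and p r q :: nat
  assumes "prime p" and "r \<ge> 1" and "q = p ^ r" and "CARD('a) = q"
    and "A \<in> mult_chars" and "B \<in> mult_chars" and "B' \<in> mult_chars" and "C \<in> mult_chars"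
  shows "appell_F1 A B B' C x y =
    1 / (of_nat q - 1)\<^sup>2 *
    (\<Sum>\<chi>\<in>mult_chars. \<Sum>\<psi>\<in>mult_chars.
       char_binom (A \<star> \<chi> \<star> \<psi>) (C \<star> \<chi> \<star> \<psi>) * char_binom (B \<star> \<chi>) \<chi> *
       char_binom (B' \<star> \<psi>) \<psi> * \<chi> x * \<psi> y)"
proof (cases "x * y = 0")
  case True
  then have "(\<Sum>\<chi>\<in>mult_chars. \<Sum>\<psi>\<in>mult_chars.
       char_binom (A \<star> \<chi> \<star> \<psi>) (C \<star> \<chi> \<star> \<psi>) * char_binom (B \<star> \<chi>) \<chi> *
       char_binom (B' \<star> \<psi>) \<psi> * \<chi> x * \<psi> y) = 0"
    by (intro sum.neutral ballI) auto
  moreover have "appell_F1 A B B' C x y = 0"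
    using True by (auto simp: appell_F1_def triv_char_def)
  ultimately show ?thesis
    by simp
next
  case False
  note A = \<open>A \<in> mult_chars\<close> and B = \<open>B \<in> mult_chars\<close>
    and B' = \<open>B' \<in> mult_chars\<close> and C = \<open>C \<in> mult_chars\<close>
  define K :: complex where "K = of_nat q - 1"
  have "q > 1"
    using assms(1-3) by (metis One_nat_def less_le_trans one_less_power prime_gt_1_nat zero_less_one)
  then have "K \<noteq> 0"
    by (simp add: K_def)
  define S where "S = (\<lambda>B z. \<Sum>\<chi>\<in>mult_chars. char_binom (B \<star> \<chi>) \<chi> * \<chi> (z::'a))"
  define E where "E = (\<lambda>u. A u * char_inv C (1 - u))"
  have summand: "char_binom (A \<star> \<chi> \<star> \<psi>) (C \<star> \<chi> \<star> \<psi>) * char_binom (B \<star> \<chi>) \<chi> *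
       char_binom (B' \<star> \<psi>) \<psi> * \<chi> x * \<psi> y
     = C (- 1) * (\<Sum>u\<in>UNIV. E u *
         ((char_binom (B \<star> \<chi>) \<chi> * \<chi> (u / (u - 1) * x)) *
          (char_binom (B' \<star> \<psi>) \<psi> * \<psi> (u / (u - 1) * y))))"
    if "\<chi> \<in> mult_chars" "\<psi> \<in> mult_chars" for \<chi> \<psi>
  proof -
    have assoc: "D \<star> \<chi> \<star> \<psi> = D \<star> (\<chi> \<star> \<psi>)" for D
      by (simp add: char_mult_def mult.assoc)
    have "char_binom (A \<star> \<chi> \<star> \<psi>) (C \<star> \<chi> \<star> \<psi>)
        = C (- 1) * (\<Sum>u\<in>UNIV. E u * (\<chi> (u / (u - 1)) * \<psi> (u / (u - 1))))"
      unfolding assoc char_binom_twist[OF A C char_mult_in_mult_chars[OF that]]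
      by (simp add: E_def char_mult_def)
    then show ?thesis
      by (simp only: char_times[OF that(1)] char_times[OF that(2)]
          sum_distrib_left sum_distrib_right mult_ac)
  qed
  have "(\<Sum>\<chi>\<in>mult_chars. \<Sum>\<psi>\<in>mult_chars.
       char_binom (A \<star> \<chi> \<star> \<psi>) (C \<star> \<chi> \<star> \<psi>) * char_binom (B \<star> \<chi>) \<chi> *
       char_binom (B' \<star> \<psi>) \<psi> * \<chi> x * \<psi> y)
     = (\<Sum>\<chi>\<in>mult_chars. \<Sum>\<psi>\<in>mult_chars. C (- 1) * (\<Sum>u\<in>UNIV. E u *
         ((char_binom (B \<star> \<chi>) \<chi> * \<chi> (u / (u - 1) * x)) *
          (char_binom (B' \<star> \<psi>) \<psi> * \<psi> (u / (u - 1) * y)))))"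
    by (intro sum.cong refl summand)
  also have "\<dots> = C (- 1) * (\<Sum>u\<in>UNIV. E u * (\<Sum>\<chi>\<in>mult_chars. \<Sum>\<psi>\<in>mult_chars.
         (char_binom (B \<star> \<chi>) \<chi> * \<chi> (u / (u - 1) * x)) *
         (char_binom (B' \<star> \<psi>) \<psi> * \<psi> (u / (u - 1) * y))))"
    by (simp only: sum_distrib_left sum.swap[of _ "UNIV :: 'a set" mult_chars])
  also have "\<dots> = C (- 1) * (\<Sum>u\<in>UNIV. E u * (S B (u / (u - 1) * x) * S B' (u / (u - 1) * y)))"
    by (simp only: S_def sum_product)
  also have "\<dots> = C (- 1) * (A (- 1) *
      (\<Sum>w\<in>UNIV. A w * (char_inv A \<star> C) (1 - w) * (S B (w * x) * S B' (w * y))))"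
    unfolding E_def
    by (simp only: sum_char_involution[OF A C, where f = "\<lambda>w. S B (w * x) * S B' (w * y)"])
  \<comment> \<open>The binomial series fails at \<open>0\<close>, but there the factor \<open>A w\<close> vanishes.\<close>
  also have "(\<Sum>w\<in>UNIV. A w * (char_inv A \<star> C) (1 - w) * (S B (w * x) * S B' (w * y)))
      = (\<Sum>w\<in>UNIV. A w * (char_inv A \<star> C) (1 - w) *
          ((K * char_inv B (1 - w * x)) * (K * char_inv B' (1 - w * y))))"
  proof (intro sum.cong refl)
    fix w
    show "A w * (char_inv A \<star> C) (1 - w) * (S B (w * x) * S B' (w * y))
      = A w * (char_inv A \<star> C) (1 - w) *
          ((K * char_inv B (1 - w * x)) * (K * char_inv B' (1 - w * y)))"
    proof (cases "w = 0")
      case w: False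
      then show ?thesis
        using False \<open>CARD('a) = q\<close> unfolding S_def K_def
        by (simp add: char_binomial_series[OF B] char_binomial_series[OF B'])
    qed (use A in simp)
  qed
  also have "C (- 1) * (A (- 1) * \<dots>) = K\<^sup>2 * appell_F1 A B B' C x y"
    using False
    by (simp add: appell_F1_def triv_char_def char_mult_def power2_eq_square sum_distrib_left mult_ac)
  finally show ?thesis
    using \<open>K \<noteq> 0\<close> by (simp add: K_def)
qed

end
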